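(* The polynomial $$f=x^6+w^2y^2z^4+w^2y^4z^2+(1-w)x^2y^2z^2\in\mathbb{R}[w,x,y,z]$$ is positive semidefinite and a sum of squares in $\mathbb{R}[[w,x,y,z]]$, but it is not a sum of squares in $\mathbb{R}(w)[[x,y,z]]$, hence not in the localization $\mathbb{R}[w,x,y,z]_{\langle w,x,y,z\rangle}$ either.
   Context: A polynomial $f\in\mathbb{R}[w,x,y,z]$ is positive semidefinite if $f(a)\geq 0$ for all $a\in\mathbb{R}^4$. Sums of squares are finite. *)

theory Defs
  imports "HOL-Computational_Algebra.Computational_Algebra"
begin

text \<open>
  Several variables are treated by iterating the one-variable types, with \<open>w\<close> innermost and
  \<open>z\<close> outermost: \<open>\<real>[w,x,y,z] = \<real>[w][x][y][z]\<close>, \<open>\<real>[[w,x,y,z]] = \<real>[[w]][[x]][[y]][[z]]\<close> and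
  \<open>\<real>(w)[[x,y,z]] = \<real>(w)[[x]][[y]][[z]]\<close>.
\<close>

type_synonym Rwxyz = "real poly poly poly poly"

definition w_var :: Rwxyz where "w_var = [:[:[:[:0, 1:]:]:]:]"
definition x_var :: Rwxyz where "x_var = [:[:[:0, 1:]:]:]"
definition y_var :: Rwxyz where "y_var = [:[:0, 1:]:]"
definition z_var :: Rwxyz where "z_var = [:0, 1:]"

text \<open>Each \<open>poly\<close> substitutes for the outermost remaining variable, so \<open>z\<close> is evaluated first.\<close>

definition eval4 :: "Rwxyz \<Rightarrow> real \<Rightarrow> real \<Rightarrow> real \<Rightarrow> real \<Rightarrow> real" where
  "eval4 p w x y z = poly (poly (poly (poly p [:[:[:z:]:]:]) [:[:y:]:]) [:x:]) w"

definition positive_semidefinite :: "Rwxyz \<Rightarrow> bool" where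
  "positive_semidefinite p \<longleftrightarrow> (\<forall>w x y z. eval4 p w x y z \<ge> 0)"

text \<open>\<open>A\<close> is intended to be (the carrier of) a subring.\<close>

definition sum_of_squares_in :: "'a::comm_ring_1 set \<Rightarrow> 'a \<Rightarrow> bool" where
  "sum_of_squares_in A a \<longleftrightarrow> (\<exists>us. set us \<subseteq> A \<and> a = (\<Sum>u\<leftarrow>us. u\<^sup>2))"

text \<open>The map \<open>A[x,y,z] \<rightarrow> B[[x,y,z]]\<close> applying \<open>h : A \<rightarrow> B\<close> to all coefficients.\<close>

definition poly3_to_fps3 ::
    "('a::zero \<Rightarrow> 'b::zero) \<Rightarrow> 'a poly poly poly \<Rightarrow> 'b fps fps fps" where
  "poly3_to_fps3 h p =
     fps_of_poly (map_poly (\<lambda>q. fps_of_poly (map_poly (\<lambda>r. fps_of_poly (map_poly h r)) q)) p)"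

definition to_power_series :: "Rwxyz \<Rightarrow> real fps fps fps fps" where
  "to_power_series = poly3_to_fps3 fps_of_poly"

definition to_power_series_over_Rw :: "Rwxyz \<Rightarrow> real poly fract fps fps fps" where
  "to_power_series_over_Rw = poly3_to_fps3 to_fract"

definition origin_ideal :: "Rwxyz set" where
  "origin_ideal = {a * w_var + b * x_var + c * y_var + d * z_var | a b c d. True}"

text \<open>
  \<open>\<real>[w,x,y,z]\<close> localized at the prime ideal \<open>\<langle>w,x,y,z\<rangle>\<close>, as a subring of the fraction field.
\<close>

definition origin_localization :: "Rwxyz fract set" where
  "origin_localization = {Fract p q | p q. q \<notin> origin_ideal}"

end

theory Submission
  imports Defs
begin

text \<open>
  For fixed \<open>w\<close>, \<open>f\<close> is a ternary sextic of Motzkin type, and everything hinges on the coefficient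
  \<open>1 - w\<close> of \<open>x\<^sup>2y\<^sup>2z\<^sup>2\<close>. In \<open>\<real>[[w]]\<close> it is the square of a unit, so \<open>f\<close> is visibly a sum of four squares.
  For \<open>w > 1\<close> it is negative, but the remaining terms compensate by the inequality between the
  arithmetic and geometric means (\<open>nonneg_form\<close>).

  Over \<open>\<real>(w)\<close> the negativity can no longer be compensated. Suppose \<open>f = \<Sum> u\<^sup>2\<close> with power series \<open>u\<close> in
  \<open>x,y,z\<close> over \<open>\<real>(w)\<close>. As the coefficients form an ordered field, the extremal monomials of the
  squares cannot cancel, so the exponents occurring in each \<open>u\<close> lie in half the Newton polyhedron
  of \<open>f\<close> (\<open>weight_bound_of_sum_of_squares\<close>). Two supporting half-spaces of it already
  rule out every way of writing \<open>x\<^sup>2y\<^sup>2z\<^sup>2\<close> as a product of two monomials of \<open>u\<close> except \<open>(xyz)\<^sup>2\<close>.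
  Comparing the coefficients of \<open>x\<^sup>2y\<^sup>2z\<^sup>2\<close> therefore makes \<open>1 - w\<close> a sum of squares in \<open>\<real>(w)\<close>. This
  is absurd, since \<open>\<real>(w)\<close> has an ordering in which \<open>w\<close> exceeds every real number.

  The localization at the origin reduces to this case. A polynomial outside \<open>\<langle>w,x,y,z\<rangle>\<close> has a
  nonzero constant coefficient in \<open>\<real>(w)\<close>, so it is invertible in \<open>\<real>(w)[[x,y,z]]\<close>, and a sum of squares
  with such denominators can be expanded there
  (\<open>sum_of_squares_over_Rw_of_localization\<close>).
\<close>

section \<open>Nonnegativity\<close>

text \<open>
  With \<open>X = x\<^sup>2\<close> and \<open>t = \<bar>yz\<bar>\<close>, the bound \<open>y\<^sup>2 + z\<^sup>2 \<ge> 2t\<close> reduces the claim to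
  \<open>(w - 1) X t\<^sup>2 \<le> X\<^sup>3 + 2 w\<^sup>2 t\<^sup>3\<close>. For \<open>w > 1\<close> even \<open>w X t\<^sup>2\<close> is dominated by a single term on the
  right: by the second one if \<open>X \<le> 2 w t\<close> and by the first one otherwise.
\<close>

lemma nonneg_form:
  fixes w x y z :: real
  shows "0 \<le> x ^ 6 + w\<^sup>2 * y\<^sup>2 * z ^ 4 + w\<^sup>2 * y ^ 4 * z\<^sup>2 + (1 - w) * x\<^sup>2 * y\<^sup>2 * z\<^sup>2"
proof -
  define X where "X = x\<^sup>2"
  define t where "t = \<bar>y * z\<bar>"
  have X: "0 \<le> X" and t: "0 \<le> t" by (simp_all add: X_def t_def)
  have t2: "t\<^sup>2 = y\<^sup>2 * z\<^sup>2" by (simp add: t_def power_mult_distrib)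
  have x6: "x ^ 6 = X ^ 3" by (simp add: X_def flip: power_mult)
  have "2 * t \<le> y\<^sup>2 + z\<^sup>2"
    using zero_le_power2[of "\<bar>y\<bar> - \<bar>z\<bar>"] by (simp add: t_def power2_diff abs_mult)
  then have "w\<^sup>2 * t\<^sup>2 * (2 * t) \<le> w\<^sup>2 * t\<^sup>2 * (y\<^sup>2 + z\<^sup>2)"
    by (intro mult_left_mono) auto
  also have "\<dots> = w\<^sup>2 * y\<^sup>2 * z ^ 4 + w\<^sup>2 * y ^ 4 * z\<^sup>2"
    unfolding t2 by algebra
  finally have amgm: "w\<^sup>2 * t\<^sup>2 * (2 * t) \<le> w\<^sup>2 * y\<^sup>2 * z ^ 4 + w\<^sup>2 * y ^ 4 * z\<^sup>2" .
  have "(w - 1) * X * t\<^sup>2 \<le> X ^ 3 + w\<^sup>2 * t\<^sup>2 * (2 * t)"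
  proof (cases "w \<le> 1")
    case True
    then have "(w - 1) * (X * t\<^sup>2) \<le> 0"
      using X by (intro mult_nonpos_nonneg) auto
    moreover have "0 \<le> X ^ 3 + w\<^sup>2 * t\<^sup>2 * (2 * t)" using X t by simp
    ultimately show ?thesis by (simp add: mult.assoc)
  next
    case False
    have "(w - 1) * (X * t\<^sup>2) \<le> w * (X * t\<^sup>2)"
      using X by (intro mult_right_mono) auto
    also have "\<dots> \<le> X ^ 3 + w\<^sup>2 * t\<^sup>2 * (2 * t)"
    proof (cases "X \<le> 2 * w * t")
      case True
      have "(w * t\<^sup>2) * X \<le> (w * t\<^sup>2) * (2 * w * t)"
        using True False by (intro mult_left_mono) auto
      then have "w * (X * t\<^sup>2) \<le> w\<^sup>2 * t\<^sup>2 * (2 * t)"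
        by (simp add: power2_eq_square mult_ac)
      moreover have "0 \<le> X ^ 3" using X by simp
      ultimately show ?thesis by linarith
    next
      case big: False
      have "w * t\<^sup>2 \<le> (2 * w * t)\<^sup>2"
      proof -
        have "w * 1 \<le> w * (4 * w)" using False by (intro mult_left_mono) auto
        then have "w * t\<^sup>2 \<le> (w * (4 * w)) * t\<^sup>2" by (intro mult_right_mono) auto
        then show ?thesis by (simp add: power2_eq_square mult_ac)
      qed
      also have "\<dots> \<le> X\<^sup>2" using big False t by (intro power_mono) auto
      finally have "X * (w * t\<^sup>2) \<le> X * X\<^sup>2" using X by (intro mult_left_mono)
      moreover have "0 \<le> w\<^sup>2 * t\<^sup>2 * (2 * t)" using t by simp
      ultimately show ?thesis by (simp add: power2_eq_square power3_eq_cube mult_ac)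
    qed
    finally show ?thesis by (simp add: mult.assoc)
  qed
  moreover have "(1 - w) * x\<^sup>2 * y\<^sup>2 * z\<^sup>2 = - ((w - 1) * X * t\<^sup>2)"
    unfolding t2 X_def by algebra
  ultimately show ?thesis using amgm x6 by linarith
qed

section \<open>Expansion homomorphisms\<close>

definition ring_homomorphism :: "('a::comm_ring_1 \<Rightarrow> 'b::comm_ring_1) \<Rightarrow> bool" where
  "ring_homomorphism h \<longleftrightarrow> h 1 = 1 \<and> (\<forall>a b. h (a + b) = h a + h b) \<and> (\<forall>a b. h (a * b) = h a * h b)"

lemma ring_homomorphism_simps:
  assumes "ring_homomorphism h"
  shows "h 0 = 0" "h 1 = 1" "h (a + b) = h a + h b" "h (a * b) = h a * h b"
    "h (a - b) = h a - h b" "h (a ^ n) = h a ^ n"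
proof -
  have one: "h 1 = 1" and add: "h (a + b) = h a + h b" and mult: "h (a * b) = h a * h b" for a b
    using assms by (auto simp: ring_homomorphism_def)
  show "h 0 = 0" using add[of 0 0] by simp
  show "h 1 = 1" "h (a + b) = h a + h b" "h (a * b) = h a * h b" by fact+
  show "h (a - b) = h a - h b" using add[of "a - b" b] by (simp add: algebra_simps)
  show "h (a ^ n) = h a ^ n" by (induction n) (simp_all add: one mult)
qed

lemma ring_homomorphism_sum:
  assumes "ring_homomorphism h"
  shows "h (sum g A) = (\<Sum>x\<in>A. h (g x))"
  by (induction A rule: infinite_finite_induct) (simp_all add: ring_homomorphism_simps[OF assms])

lemma ring_homomorphism_sum_list:
  assumes "ring_homomorphism h"
  shows "h (\<Sum>x\<leftarrow>xs. g x) = (\<Sum>x\<leftarrow>xs. h (g x))"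
  by (induction xs) (simp_all add: ring_homomorphism_simps[OF assms])

text \<open>
  The expansion maps apply this construction once per variable, so its iteration makes
  them homomorphisms.
\<close>

lemma ring_homomorphism_fps_of_map_poly:
  assumes h: "ring_homomorphism h"
  shows "ring_homomorphism (\<lambda>p. fps_of_poly (map_poly h p))"
proof -
  note hs = ring_homomorphism_simps[OF h] ring_homomorphism_sum[OF h]
  have "fps_of_poly (map_poly h 1) = 1"
    by (rule fps_ext) (simp add: coeff_map_poly hs(1,2))
  moreover have "fps_of_poly (map_poly h (p + q)) =
      fps_of_poly (map_poly h p) + fps_of_poly (map_poly h q)" for p q
    by (rule fps_ext) (simp add: coeff_map_poly hs)
  moreover have "fps_of_poly (map_poly h (p * q)) =
      fps_of_poly (map_poly h p) * fps_of_poly (map_poly h q)" for p q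
    by (rule fps_ext) (simp add: coeff_map_poly hs coeff_mult fps_mult_nth atLeast0AtMost)
  ultimately show ?thesis by (simp add: ring_homomorphism_def)
qed

lemma ring_homomorphism_poly3_to_fps3:
  assumes "ring_homomorphism h"
  shows "ring_homomorphism (poly3_to_fps3 h)"
  unfolding poly3_to_fps3_def
  by (intro ring_homomorphism_fps_of_map_poly assms)

lemma poly3_to_fps3_nth:
  assumes "h 0 = 0"
  shows "poly3_to_fps3 h p $ k $ j $ i = h (coeff (coeff (coeff p k) j) i)"
  using assms by (simp add: poly3_to_fps3_def coeff_map_poly)

lemma ring_homomorphism_to_power_series: "ring_homomorphism to_power_series"
  unfolding to_power_series_def
  by (intro ring_homomorphism_poly3_to_fps3)
     (simp add: ring_homomorphism_def fps_of_poly_add fps_of_poly_mult)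

lemma ring_homomorphism_to_power_series_over_Rw: "ring_homomorphism to_power_series_over_Rw"
  unfolding to_power_series_over_Rw_def
  by (intro ring_homomorphism_poly3_to_fps3) (simp add: ring_homomorphism_def)

section \<open>The Newton polytope of a sum of squares\<close>

lemma fps3_mult_nth:
  fixes u v :: "'a::comm_ring_1 fps fps fps"
  shows "(u * v) $ k $ j $ i =
    (\<Sum>c=0..k. \<Sum>b=0..j. \<Sum>a=0..i. u $ c $ b $ a * v $ (k - c) $ (j - b) $ (i - a))"
  by (simp add: fps_mult_nth fps_sum_nth)

text \<open>
  The coefficient of a square at twice an exponent is the square of the coefficient there as soon
  as that exponent is not the midpoint of two other exponents of the series.
\<close>

lemma fps3_square_nth_double:
  fixes u :: "'a::comm_ring_1 fps fps fps"
  assumes "\<And>a b c. a \<le> 2 * i \<Longrightarrow> b \<le> 2 * j \<Longrightarrow> c \<le> 2 * k \<Longrightarrow> u $ c $ b $ a \<noteq> 0 \<Longrightarrow>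
    u $ (2 * k - c) $ (2 * j - b) $ (2 * i - a) \<noteq> 0 \<Longrightarrow> a = i \<and> b = j \<and> c = k"
  shows "(u\<^sup>2) $ (2 * k) $ (2 * j) $ (2 * i) = (u $ k $ j $ i)\<^sup>2"
proof -
  have pull_out: "(\<Sum>x\<in>A. if P then g x else 0) = (if P then sum g A else 0)"
    for P and g :: "nat \<Rightarrow> 'a" and A
    by simp
  have "(u\<^sup>2) $ (2 * k) $ (2 * j) $ (2 * i) =
      (\<Sum>c=0..2*k. \<Sum>b=0..2*j. \<Sum>a=0..2*i.
        if c = k then if b = j then if a = i then (u $ k $ j $ i)\<^sup>2 else 0 else 0 else 0)"
    unfolding power2_eq_square[of u] fps3_mult_nth
    by (intro sum.cong refl) (use assms in \<open>fastforce simp: power2_eq_square mult_2\<close>)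
  also have "\<dots> = (u $ k $ j $ i)\<^sup>2"
    by (simp add: pull_out)
  finally show ?thesis .
qed

lemma fps3_sum_list_nth:
  fixes g :: "'b \<Rightarrow> 'a::comm_ring_1 fps fps fps"
  shows "(\<Sum>u\<leftarrow>us. g u) $ k $ j $ i = (\<Sum>u\<leftarrow>us. g u $ k $ j $ i)"
  by (induction us) simp_all

text \<open>
  A linear lower bound on the exponents of a sum of squares halves to one for each summand. Among
  all exponents of the summands take one of minimal weight, with ties broken lexicographically. It
  is not the midpoint of two other such exponents, so its double has the coefficient
  \<open>\<Sum>v. (v $ k0 $ j0 $ i0)\<^sup>2\<close>. In an ordered ring this is nonzero, so the double is
  an exponent of the sum and the minimal weight is at least \<open>d\<close>.
\<close>

lemma weight_bound_of_sum_of_squares: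
  fixes us :: "'a::linordered_idom fps fps fps list"
  assumes supp: "\<And>i j k. (\<Sum>u\<leftarrow>us. u\<^sup>2) $ k $ j $ i \<noteq> 0 \<Longrightarrow> 2 * d \<le> p * i + q * j + r * k"
    and u: "u \<in> set us" "u $ k $ j $ i \<noteq> 0"
  shows "d \<le> p * i + q * j + r * k"
proof (rule ccontr)
  define weight where "weight = (\<lambda>(i, j, k). p * i + q * j + r * k)"
  define S where "S = {(i, j, k) | i j k. \<exists>u\<in>set us. u $ k $ j $ i \<noteq> 0}"
  define R where "R = measures [weight, \<lambda>(i, j, k). i, \<lambda>(i, j, k). j, \<lambda>(i, j, k). k]"
  assume "\<not> ?thesis"
  then have light: "weight (i, j, k) < d" by (simp add: weight_def)
  have ijk: "(i, j, k) \<in> S" using u by (auto simp: S_def)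
  have "wf R" by (simp add: R_def)
  then obtain m where m: "m \<in> S" and min: "\<And>n. (n, m) \<in> R \<Longrightarrow> n \<notin> S"
    using ijk by (elim wfE_min) auto
  obtain i0 j0 k0 where m_eq: "m = (i0, j0, k0)" by (cases m)
  have "weight m \<le> weight (i, j, k)"
    using min[of "(i, j, k)"] ijk by (force simp: R_def)
  then have weight_m: "p * i0 + q * j0 + r * k0 < d" using light by (simp add: m_eq weight_def)
  have isolated: "a = i0 \<and> b = j0 \<and> c = k0"
    if "v \<in> set us" "a \<le> 2 * i0" "b \<le> 2 * j0" "c \<le> 2 * k0" "v $ c $ b $ a \<noteq> 0"
      "v $ (2 * k0 - c) $ (2 * j0 - b) $ (2 * i0 - a) \<noteq> 0" for v a b c
  proof -
    define a' b' c' where "a' = 2 * i0 - a" and "b' = 2 * j0 - b" and "c' = 2 * k0 - c"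
    have eqs: "a + a' = 2 * i0" "b + b' = 2 * j0" "c + c' = 2 * k0"
      using that by (auto simp: a'_def b'_def c'_def)
    have "((a, b, c), m) \<notin> R" "((a', b', c'), m) \<notin> R"
      using min that by (auto simp: S_def a'_def b'_def c'_def)
    moreover have "weight (a, b, c) + weight (a', b', c') = 2 * weight m"
    proof -
      have "weight (a, b, c) + weight (a', b', c') = p * (a + a') + q * (b + b') + r * (c + c')"
        by (simp add: weight_def algebra_simps)
      then show ?thesis unfolding eqs by (simp add: m_eq weight_def algebra_simps)
    qed
    ultimately show ?thesis using eqs unfolding m_eq R_def
      by (simp add: not_less) linarith
  qed
  have "(\<Sum>u\<leftarrow>us. u\<^sup>2) $ (2 * k0) $ (2 * j0) $ (2 * i0) = (\<Sum>v\<leftarrow>us. (v $ k0 $ j0 $ i0)\<^sup>2)"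
    unfolding fps3_sum_list_nth
    by (intro arg_cong[where f = sum_list] map_cong refl fps3_square_nth_double isolated)
  moreover have "(\<Sum>v\<leftarrow>us. (v $ k0 $ j0 $ i0)\<^sup>2) \<noteq> 0"
    using m by (subst sum_list_nonneg_eq_0_iff) (auto simp: S_def m_eq)
  ultimately have "2 * d \<le> p * (2 * i0) + q * (2 * j0) + r * (2 * k0)"
    by (intro supp) simp
  then show False using weight_m by simp
qed

section \<open>No sum of squares over the rational functions\<close>

lemma monomial_as_monom:
  "w_var ^ a * x_var ^ b * y_var ^ c * z_var ^ d = monom (monom (monom (monom 1 a) b) c) d"
proof -
  have vars: "w_var = monom (monom (monom (monom 1 1) 0) 0) 0" "x_var = monom (monom (monom 1 1) 0) 0"
    "y_var = monom (monom 1 1) 0" "z_var = monom 1 1"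
    by (simp_all add: w_var_def x_var_def y_var_def z_var_def monom_0 monom_Suc one_pCons)
  show ?thesis unfolding vars by (simp add: monom_power mult_monom)
qed

definition motzkin_family :: Rwxyz where
  "motzkin_family = x_var ^ 6 + w_var ^ 2 * y_var ^ 2 * z_var ^ 4 + w_var ^ 2 * y_var ^ 4 * z_var ^ 2
     + (1 - w_var) * x_var ^ 2 * y_var ^ 2 * z_var ^ 2"

lemma motzkin_family_coeff:
  "coeff (coeff (coeff motzkin_family k) j) i =
    (if (i, j, k) = (6, 0, 0) then 1
     else if (i, j, k) = (0, 2, 4) \<or> (i, j, k) = (0, 4, 2) then monom 1 2
     else if (i, j, k) = (2, 2, 2) then 1 - monom 1 1 else 0)"
proof -
  have eq: "motzkin_family = w_var ^ 0 * x_var ^ 6 * y_var ^ 0 * z_var ^ 0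
      + w_var ^ 2 * x_var ^ 0 * y_var ^ 2 * z_var ^ 4
      + w_var ^ 2 * x_var ^ 0 * y_var ^ 4 * z_var ^ 2
      + w_var ^ 0 * x_var ^ 2 * y_var ^ 2 * z_var ^ 2
      - w_var ^ 1 * x_var ^ 2 * y_var ^ 2 * z_var ^ 2"
    by (simp add: motzkin_family_def algebra_simps)
  show ?thesis
    unfolding eq monomial_as_monom by simp
qed

text \<open>
  The exponents of \<open>f\<close> have weight at least \<open>12\<close> for both \<open>(2,4,1)\<close> and \<open>(2,1,4)\<close>. Equality holds for
  \<open>x\<^sup>6\<close> together with \<open>y\<^sup>2z\<^sup>4\<close> and with \<open>y\<^sup>4z\<^sup>2\<close>, respectively: these are two edges of the triangle
  spanned by the exponents. The exponent \<open>(2,2,2)\<close> has weight \<open>14\<close>, so two exponents of a summand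
  adding up to it have both weights between \<open>6\<close> and \<open>8\<close>, which forces both to be \<open>(1,1,1)\<close>.
\<close>

lemma not_sum_of_squares_over_Rw:
  "\<not> sum_of_squares_in UNIV (to_power_series_over_Rw motzkin_family)"
proof
  assume "sum_of_squares_in UNIV (to_power_series_over_Rw motzkin_family)"
  then obtain us where us: "to_power_series_over_Rw motzkin_family = (\<Sum>u\<leftarrow>us. u\<^sup>2)"
    by (auto simp: sum_of_squares_in_def)
  have coeffs: "(\<Sum>u\<leftarrow>us. u\<^sup>2) $ k $ j $ i = to_fract (coeff (coeff (coeff motzkin_family k) j) i)" for i j k
    unfolding us[symmetric] to_power_series_over_Rw_def by (rule poly3_to_fps3_nth) simp
  have weight1: "6 \<le> 2 * i + 4 * j + 1 * k" if "u \<in> set us" "u $ k $ j $ i \<noteq> 0" for u i j k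
    by (rule weight_bound_of_sum_of_squares[OF _ that])
       (auto simp: coeffs motzkin_family_coeff split: if_splits)
  have weight2: "6 \<le> 2 * i + 1 * j + 4 * k" if "u \<in> set us" "u $ k $ j $ i \<noteq> 0" for u i j k
    by (rule weight_bound_of_sum_of_squares[OF _ that])
       (auto simp: coeffs motzkin_family_coeff split: if_splits)
  have square: "(u\<^sup>2) $ (2 * 1) $ (2 * 1) $ (2 * 1) = (u $ 1 $ 1 $ 1)\<^sup>2" if u: "u \<in> set us" for u
  proof (rule fps3_square_nth_double)
    fix a b c :: nat
    assume le: "a \<le> 2 * 1" "b \<le> 2 * 1" "c \<le> 2 * 1"
      and nz: "u $ c $ b $ a \<noteq> 0" "u $ (2 * 1 - c) $ (2 * 1 - b) $ (2 * 1 - a) \<noteq> 0"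
    define a' b' c' where "a' = 2 * 1 - a" and "b' = 2 * 1 - b" and "c' = 2 * 1 - c"
    then have sums: "a + a' = 2" "b + b' = 2" "c + c' = 2" using le by auto
    have "6 \<le> 2 * a + 4 * b + c" "6 \<le> 2 * a + b + 4 * c"
      using weight1[OF u nz(1)] weight2[OF u nz(1)] by auto
    moreover have "6 \<le> 2 * a' + 4 * b' + c'" "6 \<le> 2 * a' + b' + 4 * c'"
      using weight1[OF u nz(2)] weight2[OF u nz(2)] by (auto simp: a'_def b'_def c'_def)
    ultimately have upper: "6 \<le> 2 * a + 4 * b + c" "2 * a + 4 * b + c \<le> 8"
      "6 \<le> 2 * a + b + 4 * c" "2 * a + b + 4 * c \<le> 8" using sums by linarith+
    have "b = 0 \<or> b = 1 \<or> b = 2" "c = 0 \<or> c = 1 \<or> c = 2" using le by auto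
    then show "a = 1 \<and> b = 1 \<and> c = 1" using upper le(1) by (elim disjE) auto
  qed
  have "(\<Sum>u\<leftarrow>us. u\<^sup>2) $ 2 $ 2 $ 2 = (\<Sum>u\<leftarrow>us. (u\<^sup>2) $ 2 $ 2 $ 2)"
    by (rule fps3_sum_list_nth)
  also have "\<dots> = (\<Sum>u\<leftarrow>us. (u $ 1 $ 1 $ 1)\<^sup>2)"
    by (intro arg_cong[where f = sum_list] map_cong refl square[unfolded mult_1_right])
  also have "\<dots> \<ge> 0" by (intro sum_list_nonneg) auto
  finally have "0 \<le> to_fract (1 - monom 1 1 :: real poly)"
    by (simp add: coeffs motzkin_family_coeff)
  \<comment> \<open>The order on polynomials is by the sign of the leading coefficient, which is \<open>-1\<close> here.\<close>
  moreover have "to_fract (1 - monom 1 1 :: real poly) < 0"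
    by (simp add: to_fract_def Fract_less_zero_iff less_poly_def pos_poly_def
        monom_Suc monom_0 one_pCons)
  ultimately show False by simp
qed

section \<open>The localization at the origin\<close>

text \<open>
  A polynomial without constant term is split by the variables that occur: the coefficient of
  \<open>z\<^sup>0\<close> is separated first, then that of \<open>y\<^sup>0\<close> in it, and so on down to \<open>w\<close>.
\<close>

lemma origin_ideal_eq: "origin_ideal = {q. coeff (coeff (coeff (coeff q 0) 0) 0) 0 = 0}"
proof (intro equalityI subsetI)
  fix q assume "q \<in> origin_ideal"
  then show "q \<in> {q. coeff (coeff (coeff (coeff q 0) 0) 0) 0 = 0}"
    by (auto simp: origin_ideal_def w_var_def x_var_def y_var_def z_var_def coeff_mult)
next
  fix q :: Rwxyz assume "q \<in> {q. coeff (coeff (coeff (coeff q 0) 0) 0) 0 = 0}"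
  then have const: "coeff (coeff (coeff (coeff q 0) 0) 0) 0 = 0" by simp
  obtain q1 d where q: "q = pCons q1 d" by (cases q)
  obtain q2 c where q1: "q1 = pCons q2 c" by (cases q1)
  obtain q3 b where q2: "q2 = pCons q3 b" by (cases q2)
  obtain q4 a where q3: "q3 = pCons q4 a" by (cases q3)
  have "q4 = 0" using const by (simp add: q q1 q2 q3)
  then have "q = [:[:[:a:]:]:] * w_var + [:[:b:]:] * x_var + [:c:] * y_var + d * z_var"
    by (simp add: q q1 q2 q3 w_var_def x_var_def y_var_def z_var_def)
  then show "q \<in> origin_ideal" unfolding origin_ideal_def by blast
qed

lemma origin_ideal_prime: "a * b \<in> origin_ideal \<Longrightarrow> a \<in> origin_ideal \<or> b \<in> origin_ideal"
  by (simp add: origin_ideal_eq coeff_mult)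

text \<open>
  The denominators can be gathered into a single square because the complement of the prime ideal is
  multiplicatively closed.
\<close>

lemma clear_denominators:
  assumes "set us \<subseteq> origin_localization"
  shows "\<exists>q ps. q \<notin> origin_ideal \<and> (to_fract q)\<^sup>2 * (\<Sum>u\<leftarrow>us. u\<^sup>2) = to_fract (\<Sum>p\<leftarrow>ps. p\<^sup>2)"
  using assms
proof (induction us)
  case Nil
  have "1 \<notin> origin_ideal" by (simp add: origin_ideal_eq)
  then show ?case by (intro exI[of _ 1] exI[of _ "[]"]) simp
next
  case (Cons u us)
  then obtain q ps where q: "q \<notin> origin_ideal"
    and ps: "(to_fract q)\<^sup>2 * (\<Sum>u\<leftarrow>us. u\<^sup>2) = to_fract (\<Sum>p\<leftarrow>ps. p\<^sup>2)" by auto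
  from Cons.prems obtain a b where u: "u = Fract a b" and b: "b \<notin> origin_ideal"
    by (auto simp: origin_localization_def)
  have "b \<noteq> 0" using b by (auto simp: origin_ideal_eq)
  then have bu: "to_fract b * u = to_fract a" by (simp add: u to_fract_def eq_fract)
  have "(to_fract (b * q))\<^sup>2 * (\<Sum>u\<leftarrow>u # us. u\<^sup>2)
      = (to_fract q)\<^sup>2 * (to_fract b * u)\<^sup>2 + (to_fract b)\<^sup>2 * ((to_fract q)\<^sup>2 * (\<Sum>u\<leftarrow>us. u\<^sup>2))"
    by (simp add: algebra_simps power_mult_distrib)
  also have "\<dots> = to_fract ((q * a)\<^sup>2 + b\<^sup>2 * (\<Sum>p\<leftarrow>ps. p\<^sup>2))"
    unfolding bu ps by (simp add: power2_eq_square algebra_simps)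
  also have "(q * a)\<^sup>2 + b\<^sup>2 * (\<Sum>p\<leftarrow>ps. p\<^sup>2) = (\<Sum>p\<leftarrow>q * a # map ((*) b) ps. p\<^sup>2)"
    by (simp add: sum_list_const_mult power_mult_distrib o_def)
  finally show ?case using b q origin_ideal_prime by blast
qed

lemma fps_dvd_1:
  fixes F :: "'a::comm_ring_1 fps"
  assumes "F $ 0 dvd 1"
  shows "F dvd 1"
proof -
  from assms obtain y where "F $ 0 * y = 1" by (metis dvdE)
  then have "F * fps_right_inverse F y = 1" by (rule fps_right_inverse)
  then show ?thesis by (metis dvdI)
qed

lemma unit_over_Rw:
  assumes "q \<notin> origin_ideal"
  shows "to_power_series_over_Rw q dvd 1"
proof -
  have "coeff (coeff (coeff q 0) 0) 0 \<noteq> 0" using assms by (auto simp: origin_ideal_eq)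
  then have "to_power_series_over_Rw q $ 0 $ 0 $ 0 \<noteq> 0"
    by (simp add: to_power_series_over_Rw_def poly3_to_fps3_nth)
  then have "to_power_series_over_Rw q $ 0 $ 0 $ 0 dvd 1" by (simp add: dvd_field_iff)
  then show ?thesis by (intro fps_dvd_1)
qed

text \<open>
  Working with a cleared denominator \<open>q\<close> avoids extending the expansion map to the localization:
  the identity \<open>q\<^sup>2 p = \<Sum> p\<^sub>i\<^sup>2\<close> holds between polynomials, and only the image of \<open>q\<close> has to be
  inverted, in the power series ring.
\<close>

lemma sum_of_squares_over_Rw_of_localization:
  assumes "sum_of_squares_in origin_localization (to_fract p)"
  shows "sum_of_squares_in UNIV (to_power_series_over_Rw p)"
proof -
  note hom = ring_homomorphism_to_power_series_over_Rw
  let ?\<phi> = to_power_series_over_Rw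
  from assms obtain us where "set us \<subseteq> origin_localization" and p: "to_fract p = (\<Sum>u\<leftarrow>us. u\<^sup>2)"
    by (auto simp: sum_of_squares_in_def)
  then obtain q ps where q: "q \<notin> origin_ideal"
    and "(to_fract q)\<^sup>2 * to_fract p = to_fract (\<Sum>p\<leftarrow>ps. p\<^sup>2)"
    using clear_denominators by metis
  then have "to_fract (q\<^sup>2 * p) = to_fract (\<Sum>p\<leftarrow>ps. p\<^sup>2)"
    by (simp add: power2_eq_square)
  then have "q\<^sup>2 * p = (\<Sum>p\<leftarrow>ps. p\<^sup>2)" by (simp only: to_fract_eq_iff)
  then have "?\<phi> (q\<^sup>2 * p) = ?\<phi> (\<Sum>p\<leftarrow>ps. p\<^sup>2)" by simp
  then have eq: "(?\<phi> q)\<^sup>2 * ?\<phi> p = (\<Sum>p\<leftarrow>ps. (?\<phi> p)\<^sup>2)"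
    by (simp add: ring_homomorphism_simps[OF hom] ring_homomorphism_sum_list[OF hom])
  obtain v where v: "1 = ?\<phi> q * v" using unit_over_Rw[OF q] by (elim dvdE)
  have "?\<phi> p = (?\<phi> q * v)\<^sup>2 * ?\<phi> p" by (simp flip: v)
  also have "\<dots> = v\<^sup>2 * ((?\<phi> q)\<^sup>2 * ?\<phi> p)" by (simp add: power_mult_distrib mult_ac)
  also have "\<dots> = (\<Sum>u\<leftarrow>map (\<lambda>p. v * ?\<phi> p) ps. u\<^sup>2)"
    by (simp add: eq sum_list_const_mult power_mult_distrib o_def)
  finally show ?thesis unfolding sum_of_squares_in_def by blast
qed

section \<open>The sum of squares in the power series ring\<close>

text \<open>
  The square root \<open>s\<close> of \<open>1 - w\<close> is a power series because the constant coefficient \<open>1\<close> is a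
  square; \<open>\<lambda>_ _. 1\<close> below chooses \<open>1\<close> as its root.
\<close>

lemma sum_of_squares_power_series:
  "sum_of_squares_in UNIV (to_power_series motzkin_family)"
proof -
  note hom = ring_homomorphism_to_power_series
  define s :: "real fps" where "s = fps_radical (\<lambda>_ _. 1) 2 (1 - fps_X)"
  define S :: "real fps fps fps fps" where "S = fps_const (fps_const (fps_const s))"
  define W X Y Z where "W = to_power_series w_var" and "X = to_power_series x_var"
    and "Y = to_power_series y_var" and "Z = to_power_series z_var"
  have "s\<^sup>2 = 1 - fps_X"
    using power_radical[of "1 - fps_X :: real fps" "\<lambda>_ _. 1" 1]
    by (simp add: s_def numeral_2_eq_2)
  moreover have "W = fps_const (fps_const (fps_const fps_X))"
    by (simp add: W_def to_power_series_def poly3_to_fps3_def w_var_def map_poly_pCons fps_of_poly_simps)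
  ultimately have S: "S\<^sup>2 = 1 - W"
    by (simp add: S_def)
  have "to_power_series motzkin_family
      = X ^ 6 + W\<^sup>2 * Y\<^sup>2 * Z ^ 4 + W\<^sup>2 * Y ^ 4 * Z\<^sup>2 + S\<^sup>2 * X\<^sup>2 * Y\<^sup>2 * Z\<^sup>2"
    unfolding S by (simp add: motzkin_family_def ring_homomorphism_simps[OF hom] W_def X_def Y_def Z_def)
  also have "\<dots> = (\<Sum>u\<leftarrow>[X ^ 3, W * Y * Z\<^sup>2, W * Y\<^sup>2 * Z, S * X * Y * Z]. u\<^sup>2)"
    by (simp add: power_mult_distrib flip: power_mult)
  finally show ?thesis unfolding sum_of_squares_in_def by blast
qed

theorem theorem3p15:
  fixes f :: Rwxyz
  assumes "f = x_var ^ 6 + w_var ^ 2 * y_var ^ 2 * z_var ^ 4 + w_var ^ 2 * y_var ^ 4 * z_var ^ 2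
             + (1 - w_var) * x_var ^ 2 * y_var ^ 2 * z_var ^ 2"
  shows "positive_semidefinite f
    \<and> sum_of_squares_in UNIV (to_power_series f)
    \<and> \<not> sum_of_squares_in UNIV (to_power_series_over_Rw f)
    \<and> \<not> sum_of_squares_in origin_localization (to_fract f)"
proof -
  have f: "f = motzkin_family" using assms by (simp add: motzkin_family_def)
  have "eval4 f w x y z =
      x ^ 6 + w\<^sup>2 * y\<^sup>2 * z ^ 4 + w\<^sup>2 * y ^ 4 * z\<^sup>2 + (1 - w) * x\<^sup>2 * y\<^sup>2 * z\<^sup>2" for w x y z
    by (simp add: assms eval4_def w_var_def x_var_def y_var_def z_var_def)
  then have "positive_semidefinite f"
    by (simp add: positive_semidefinite_def nonneg_form)
  then show ?thesis
    using sum_of_squares_power_series not_sum_of_squares_over_Rw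
      sum_of_squares_over_Rw_of_localization
    by (auto simp: f)
qed

end
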